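(* Let $S$ be a finite set, let $S_1,\dots,S_n\subseteq S$, and let $k\ge 2$ be an integer. For a partition of $\{S_1,\dots,S_n\}$ into $k$ covers $c_1,\dots,c_k$, define its coverage as $\sum_{i=1}^k \left|\bigcup_{S_j\in c_i} S_j\right|$, and let $\mathrm{OPT}$ be the maximum coverage over all such partitions. Consider the centralized greedy algorithm: starting with all covers empty, for $j=1,2,\dots,n$ in order, for each $v\in S_j$ let $y_v$ be the number of subsets among $S_j,S_{j+1},\dots,S_n$ that contain $v$ (the subsets containing $v$ not yet assigned, including $S_j$), and assign $S_j$ to a cover $c_i$ maximizing $$\sum_{v\in S_j,\ v\notin \bigcup_{S_{j'}\in c_i} S_{j'}} \left(1-\frac{1}{k}\right)^{y_v-1},$$ where the union is over subsets already assigned to $c_i$ (ties broken arbitrarily). Then the coverage of the resulting partition is at least $\left(1-\frac{1}{e}\right)\mathrm{OPT}$.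
   Context: This is the SET K-COVER problem: given $S$, the collection $\{S_j\}_{j=1}^n$ and $k$, find a partition of the subsets into $k$ covers maximizing $\sum_{i=1}^k |\bigcup_{S_j\in c_i} S_j|$. *)

theory Defs
  imports Complex_Main "HOL-Library.Disjoint_Sets"
begin

text \<open>
  The collection \<open>S\<^sub>1, \<dots>, S\<^sub>n\<close> is an indexed family (the same set may occur several times), so a cover
  is a set of indices and the covers \<open>c\<^sub>1, \<dots>, c\<^sub>k\<close> are a function whose values matter on \<open>{1..k}\<close>.
  Covers may be empty, as they are at the start of the algorithm.
\<close>

definition k_partition :: "nat \<Rightarrow> nat \<Rightarrow> (nat \<Rightarrow> nat set) \<Rightarrow> bool" where
  "k_partition n k c \<longleftrightarrow> disjoint_family_on c {1..k} \<and> (\<Union>i\<in>{1..k}. c i) = {1..n}"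

definition coverage :: "(nat \<Rightarrow> 'a set) \<Rightarrow> nat \<Rightarrow> (nat \<Rightarrow> nat set) \<Rightarrow> nat" where
  "coverage S k c = (\<Sum>i=1..k. card (\<Union>j\<in>c i. S j))"

definition OPT :: "(nat \<Rightarrow> 'a set) \<Rightarrow> nat \<Rightarrow> nat \<Rightarrow> nat" where
  "OPT S n k = Max (coverage S k ` {c. k_partition n k c})"

definition remaining :: "(nat \<Rightarrow> 'a set) \<Rightarrow> nat \<Rightarrow> nat \<Rightarrow> 'a \<Rightarrow> nat" where
  "remaining S n j v = card {l \<in> {j..n}. v \<in> S l}"

text \<open>The exponent is not truncated: \<open>v \<in> S j\<close> and \<open>j \<le> n\<close> give \<open>remaining S n j v \<ge> 1\<close>.\<close>

definition gain :: "(nat \<Rightarrow> 'a set) \<Rightarrow> nat \<Rightarrow> nat \<Rightarrow> (nat \<Rightarrow> nat set) \<Rightarrow> nat \<Rightarrow> nat \<Rightarrow> real" where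
  "gain S n k c j i =
     (\<Sum>v\<in>S j - (\<Union>l\<in>c i. S l). (1 - 1 / real k) ^ (remaining S n j v - 1))"

text \<open>
  \<open>greedy S n k j c\<close>: some run of the algorithm, for some resolution of ties, has the covers \<open>c\<close>
  after assigning \<open>S\<^sub>1, \<dots>, S\<^sub>j\<close>.
\<close>

inductive greedy :: "(nat \<Rightarrow> 'a set) \<Rightarrow> nat \<Rightarrow> nat \<Rightarrow> nat \<Rightarrow> (nat \<Rightarrow> nat set) \<Rightarrow> bool"
  for S :: "nat \<Rightarrow> 'a set" and n k :: nat where
  start: "greedy S n k 0 (\<lambda>_. {})"
| assign: "greedy S n k (Suc j) (c(i := insert (Suc j) (c i)))"
    if "greedy S n k j c" and "Suc j \<le> n" and "i \<in> {1..k}"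
      and "\<forall>i'\<in>{1..k}. gain S n k c (Suc j) i' \<le> gain S n k c (Suc j) i"

lemma greedy_k_partition: "greedy S n k j c \<Longrightarrow> k_partition j k c"
proof (induction rule: greedy.induct)
  case start
  then show ?case by (auto simp: k_partition_def disjoint_family_on_def)
next
  case (assign j c i)
  have sub: "c l \<subseteq> {1..j}" if "l \<in> {1..k}" for l
    using assign.IH that by (auto simp: k_partition_def)
  have new: "Suc j \<notin> c l" if "l \<in> {1..k}" for l
    using sub[OF that] by auto
  have "disjoint_family_on (c(i := insert (Suc j) (c i))) {1..k}"
    using assign.IH new unfolding k_partition_def disjoint_family_on_def by auto
  moreover have "(\<Union>l\<in>{1..k}. (c(i := insert (Suc j) (c i))) l) = insert (Suc j) (\<Union>l\<in>{1..k}. c l)"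
    using \<open>i \<in> {1..k}\<close> by (auto split: if_splits)
  moreover have "insert (Suc j) {1..j} = {1..Suc j}" by auto
  ultimately show ?case using assign.IH unfolding k_partition_def by metis
qed

lemma greedy_exists:
  assumes "k \<ge> 1" "j \<le> n"
  shows "\<exists>c. greedy S n k j c"
  using assms(2)
proof (induction j)
  case 0
  then show ?case using greedy.start by blast
next
  case (Suc j)
  then obtain c where c: "greedy S n k j c" by auto
  let ?G = "gain S n k c (Suc j) ` {1..k}"
  have "Max ?G \<in> ?G" using assms(1) by (intro Max_in) auto
  then obtain i where i: "i \<in> {1..k}" "Max ?G = gain S n k c (Suc j) i" by auto
  have "\<forall>i'\<in>{1..k}. gain S n k c (Suc j) i' \<le> gain S n k c (Suc j) i"
    using i(2)[symmetric] by simp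
  then show ?case using greedy.assign[OF c Suc.prems i(1)] by blast
qed

lemma finite_coverages: "finite (coverage S k ` {c. k_partition n k c})"
proof -
  let ?P = "PiE {1..k} (\<lambda>_. Pow {1..n})"
  have "coverage S k c \<in> coverage S k ` ?P" if "k_partition n k c" for c
  proof
    show "coverage S k c = coverage S k (restrict c {1..k})"
      by (simp add: coverage_def)
    show "restrict c {1..k} \<in> ?P"
      using that by (auto simp: k_partition_def)
  qed
  then have "coverage S k ` {c. k_partition n k c} \<subseteq> coverage S k ` ?P" by blast
  moreover have "finite ?P" by (intro finite_PiE) auto
  ultimately show ?thesis by (meson finite_imageI finite_subset)
qed

text \<open>For \<open>k \<ge> 1\<close> the maximum is over a finite nonempty set, hence attained.\<close>

lemma OPT_upper: "k_partition n k c \<Longrightarrow> coverage S k c \<le> OPT S n k"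
  unfolding OPT_def by (intro Max_ge finite_coverages) auto

lemma OPT_attained:
  assumes "k \<ge> 1"
  shows "\<exists>c. k_partition n k c \<and> coverage S k c = OPT S n k"
proof -
  obtain c where "k_partition n k c"
    using greedy_exists[OF assms order_refl] greedy_k_partition by blast
  then have "OPT S n k \<in> coverage S k ` {c. k_partition n k c}"
    unfolding OPT_def by (intro Max_in finite_coverages) auto
  then show ?thesis by auto
qed

end

theory Submission
  imports Defs "HOL-Analysis.Convex"
begin

text \<open>
  Derandomisation by conditional expectations. If every subset still to come were put into a
  uniformly random cover, an element \<open>v\<close> occurring in \<open>r\<close> of them would remain missing from a
  cover that does not yet contain it with probability \<open>(1 - 1/k)^r\<close>. The greedy choice minimises
  the expected number of missing pairs (element, cover), which is therefore never
  larger than its initial value \<open>\<Sum>v. k * (1 - 1/k)^y\<^sub>v\<close>, where \<open>y\<^sub>v\<close> is the number of subsets containing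
  \<open>v\<close>. On the other hand \<open>OPT \<le> (\<Sum>v. min k y\<^sub>v)\<close>, and
  \<open>k * (1 - (1 - 1/k)^y) \<ge> (1 - 1/e) * min k y\<close> by convexity of the exponential function.
\<close>

lemma exp_minus_le_chord:
  fixes t :: real
  assumes "0 \<le> t" "t \<le> 1"
  shows "exp (- t) \<le> 1 - (1 - 1 / exp 1) * t"
  using convex_onD[OF exp_convex, of t 0 "-1"] assms
  by (simp add: exp_minus field_simps)

text \<open>From \<open>1 - x \<le> exp (- x)\<close> the power is at most
  \<open>exp (- (y / k))\<close>. Capping \<open>y\<close> at \<open>k\<close> puts
  \<open>t = min k y / k\<close> into the interval from 0 to 1, where the exponential lies below its
  chord.\<close>

lemma min_le_one_minus_power:
  fixes k y :: nat
  assumes "k \<ge> 1"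
  shows "(1 - 1 / exp 1) * real (min k y) \<le> real k * (1 - (1 - 1 / real k) ^ y)"
proof -
  define t where "t = real (min k y) / real k"
  have t: "0 \<le> t" "t \<le> 1" "t \<le> real y / real k"
    using assms by (auto simp: t_def field_simps)
  have "(1 - 1 / real k) ^ y \<le> exp (- (1 / real k)) ^ y"
    using assms exp_ge_add_one_self[of "- (1 / real k)"] by (intro power_mono) auto
  also have "\<dots> = exp (- (real y / real k))"
    by (simp flip: exp_of_nat_mult)
  also have "\<dots> \<le> exp (- t)"
    using t by simp
  also have "\<dots> \<le> 1 - (1 - 1 / exp 1) * t"
    using t by (intro exp_minus_le_chord)
  finally have "real k * ((1 - 1 / exp 1) * t) \<le> real k * (1 - (1 - 1 / real k) ^ y)"
    by (intro mult_left_mono) auto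
  then show ?thesis
    using assms by (simp add: t_def mult.left_commute)
qed

text \<open>The conditional expectation after \<open>j\<close> assignments; the exponent starts at
  \<open>Suc j\<close> because only later subsets are still random.\<close>

definition missing :: "'a set \<Rightarrow> (nat \<Rightarrow> 'a set) \<Rightarrow> nat \<Rightarrow> nat \<Rightarrow> nat \<Rightarrow> (nat \<Rightarrow> nat set) \<Rightarrow> real" where
  "missing U S n k j c =
     (\<Sum>i=1..k. \<Sum>v\<in>U - (\<Union>l\<in>c i. S l). (1 - 1 / real k) ^ remaining S n (Suc j) v)"

lemma remaining_Suc:
  assumes "j \<le> n"
  shows "remaining S n j v = (if v \<in> S j then Suc (remaining S n (Suc j) v) else remaining S n (Suc j) v)"
proof -
  have "{l \<in> {j..n}. v \<in> S l} =
      (if v \<in> S j then insert j {l \<in> {Suc j..n}. v \<in> S l} else {l \<in> {Suc j..n}. v \<in> S l})"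
    using assms by (auto simp: Suc_le_eq order.order_iff_strict)
  then show ?thesis
    by (simp add: remaining_def)
qed

text \<open>A maximum is at least the average. Fixing the place of \<open>S (Suc j)\<close> costs
  its elements the factor \<open>q = 1 - 1/k\<close>, which adds \<open>1/k\<close> times the sum of
  all gains, while the chosen cover removes \<open>g i\<close>, the largest gain.\<close>

lemma missing_assign_le:
  assumes "finite U" "S (Suc j) \<subseteq> U" "Suc j \<le> n" "i \<in> {1..k}"
    and best: "\<forall>i'\<in>{1..k}. gain S n k c (Suc j) i' \<le> gain S n k c (Suc j) i"
  shows "missing U S n k (Suc j) (c(i := insert (Suc j) (c i))) \<le> missing U S n k j c"
proof -
  define q where "q = 1 - 1 / real k"
  define C where "C l = (\<Union>x\<in>c l. S x)" for l
  define g where "g = gain S n k c (Suc j)"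
  define B where "B l = (\<Sum>v\<in>U - C l - S (Suc j). q ^ remaining S n (Suc (Suc j)) v)" for l
  have k: "real k > 0" using assms(4) by auto
  note rem = remaining_Suc[OF assms(3), of S]
  have fin: "finite (S (Suc j))" using assms(1,2) finite_subset by blast
  \<comment> \<open>For \<open>v\<close> in \<open>S (Suc j)\<close> the exponent
    \<open>remaining - 1\<close> in \<open>gain\<close> counts exactly the subsets after
    \<open>S (Suc j)\<close>, so a gain is a sum of weights as they stand after the
    assignment.\<close>
  have g: "g l = (\<Sum>v\<in>S (Suc j) - C l. q ^ remaining S n (Suc (Suc j)) v)" for l
    unfolding g_def gain_def q_def C_def by (intro sum.cong) (auto simp: rem)
  have split: "(\<Sum>v\<in>U - C l. f v) = (\<Sum>v\<in>U - C l - S (Suc j). f v) + (\<Sum>v\<in>S (Suc j) - C l. f v)"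
    for f :: "'a \<Rightarrow> real" and l
    using assms(1,2) fin by (subst sum.union_disjoint[symmetric]) (auto intro!: sum.cong)
  have old: "missing U S n k j c = (\<Sum>l=1..k. B l + q * g l)"
    unfolding missing_def q_def[symmetric] C_def[symmetric] split g B_def sum_distrib_left
    by (intro sum.cong refl arg_cong2[where f = "(+)"]) (auto simp: rem)
  have new: "missing U S n k (Suc j) (c(i := insert (Suc j) (c i)))
      = (\<Sum>l=1..k. B l + (if l = i then 0 else g l))"
    unfolding missing_def q_def[symmetric]
  proof (intro sum.cong refl, goal_cases)
    case (1 l)
    show ?case
    proof (cases "l = i")
      case True
      then have "U - (\<Union>x\<in>(c(i := insert (Suc j) (c i))) l. S x) = U - C l - S (Suc j)"
        by (auto simp: C_def)
      then show ?thesis using True by (simp add: B_def)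
    next
      case False
      then show ?thesis by (simp add: C_def[symmetric] split g B_def)
    qed
  qed
  have "(\<Sum>l=1..k. g l) \<le> real k * g i"
    using sum_bounded_above[of "{1..k}" g "g i"] best by (auto simp: g_def)
  then have "(\<Sum>l=1..k. g l) / real k \<le> g i"
    using k by (simp add: field_simps)
  moreover have "(\<Sum>l=1..k. if l = i then 0 else g l) = (\<Sum>l=1..k. g l) - g i"
    using assms(4) by (simp add: sum.If_cases sum_diff1 flip: Diff_eq)
  moreover have "q * (\<Sum>l=1..k. g l) = (\<Sum>l=1..k. g l) - (\<Sum>l=1..k. g l) / real k"
    by (simp add: q_def algebra_simps)
  ultimately show ?thesis
    unfolding old new sum.distrib sum_distrib_left[symmetric] by linarith
qed

lemma greedy_missing_le:
  assumes "greedy S n k j c" "finite U" "\<forall>j\<in>{1..n}. S j \<subseteq> U"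
  shows "missing U S n k j c \<le> missing U S n k 0 (\<lambda>_. {})"
  using assms(1)
proof (induction rule: greedy.induct)
  case (assign j c i)
  then have "missing U S n k (Suc j) (c(i := insert (Suc j) (c i))) \<le> missing U S n k j c"
    using assms(2,3) by (intro missing_assign_le) auto
  then show ?case using assign.IH by linarith
qed simp

lemma covered_subset:
  assumes "k_partition n k c" "\<forall>j\<in>{1..n}. S j \<subseteq> U" "i \<in> {1..k}"
  shows "(\<Union>l\<in>c i. S l) \<subseteq> U"
  using assms unfolding k_partition_def by blast

text \<open>After step \<open>n\<close> nothing remains, so all exponents are 0 and
  \<open>missing\<close> simply counts the uncovered pairs.\<close>

lemma missing_eq_coverage:
  assumes "k_partition n k c" "finite U" "\<forall>j\<in>{1..n}. S j \<subseteq> U"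
  shows "missing U S n k n c = real k * real (card U) - real (coverage S k c)"
proof -
  have "missing U S n k n c = (\<Sum>i=1..k. real (card U) - real (card (\<Union>l\<in>c i. S l)))"
    unfolding missing_def
  proof (intro sum.cong refl, goal_cases)
    case (1 i)
    have "(\<Union>l\<in>c i. S l) \<subseteq> U" using covered_subset[OF assms(1,3) 1] .
    then show ?case
      using assms(2)
      by (simp add: remaining_def card_Diff_subset finite_subset card_mono of_nat_diff)
  qed
  then show ?thesis by (simp add: coverage_def sum_subtractf)
qed

text \<open>Double counting: an element contributes at most once per cover, and at most once per
  subset containing it, since each index lies in a single cover.\<close>

lemma coverage_le_sum_min:
  assumes "k_partition n k c" "finite U" "\<forall>j\<in>{1..n}. S j \<subseteq> U"
  shows "coverage S k c \<le> (\<Sum>v\<in>U. min k (remaining S n 1 v))"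
proof -
  have "card (\<Union>l\<in>c i. S l) = (\<Sum>v\<in>U. of_bool (\<exists>l\<in>c i. v \<in> S l))" if "i \<in> {1..k}" for i
    using covered_subset[OF assms(1,3) that] assms(2)
    by (simp add: Int_def) (auto intro!: arg_cong[where f = card])
  then have "coverage S k c = (\<Sum>i=1..k. \<Sum>v\<in>U. of_bool (\<exists>l\<in>c i. v \<in> S l))"
    by (simp add: coverage_def)
  also have "\<dots> = (\<Sum>v\<in>U. \<Sum>i=1..k. of_bool (\<exists>l\<in>c i. v \<in> S l))"
    by (rule sum.swap)
  also have "\<dots> \<le> (\<Sum>v\<in>U. min k (remaining S n 1 v))"
  proof (rule sum_mono)
    fix v
    have fin: "finite (c i)" if "i \<in> {1..k}" for i
      using assms(1) that unfolding k_partition_def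
      by (metis UN_upper finite_atLeastAtMost finite_subset)
    have "(\<Sum>i=1..k. of_bool (\<exists>l\<in>c i. v \<in> S l)) \<le> (\<Sum>i=1..k. card {l \<in> c i. v \<in> S l})"
    proof (rule sum_mono)
      fix i assume "i \<in> {1..k}"
      then show "of_bool (\<exists>l\<in>c i. v \<in> S l) \<le> card {l \<in> c i. v \<in> S l}"
        using fin[of i] by (auto simp: Suc_le_eq card_gt_0_iff)
    qed
    also have "\<dots> = card (\<Union>i\<in>{1..k}. {l \<in> c i. v \<in> S l})"
      using assms(1) fin
      by (intro card_UN_disjoint[symmetric]) (auto simp: k_partition_def disjoint_family_on_def)
    also have "(\<Union>i\<in>{1..k}. {l \<in> c i. v \<in> S l}) = {l \<in> {1..n}. v \<in> S l}"
      using assms(1) unfolding k_partition_def by blast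
    finally have "(\<Sum>i=1..k. of_bool (\<exists>l\<in>c i. v \<in> S l)) \<le> remaining S n 1 v"
      by (simp add: remaining_def)
    moreover have "(\<Sum>i=1..k. of_bool (\<exists>l\<in>c i. v \<in> S l)) \<le> k"
      using sum_bounded_above[of "{1..k}" "\<lambda>i. of_bool (\<exists>l\<in>c i. v \<in> S l)" "1::nat"] by simp
    ultimately show "(\<Sum>i=1..k. of_bool (\<exists>l\<in>c i. v \<in> S l)) \<le> min k (remaining S n 1 v)"
      by simp
  qed
  finally show ?thesis .
qed

theorem theorem3:
  fixes U :: "'a set" and S :: "nat \<Rightarrow> 'a set" and n k :: nat and c :: "nat \<Rightarrow> nat set"
  assumes "finite U"
    and "\<forall>j\<in>{1..n}. S j \<subseteq> U"
    and "k \<ge> 2"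
    and "greedy S n k n c"
  shows "real (coverage S k c) \<ge> (1 - 1 / exp 1) * real (OPT S n k)"
proof -
  let ?y = "remaining S n 1"
  obtain d where d: "k_partition n k d" "coverage S k d = OPT S n k"
    using OPT_attained[of k n S] assms(3) by auto
  have "(1 - 1 / exp 1) * real (OPT S n k) \<le> (1 - 1 / exp 1) * real (\<Sum>v\<in>U. min k (?y v))"
    using coverage_le_sum_min[OF d(1) assms(1,2)] d(2)
    by (intro mult_left_mono) (simp_all del: of_nat_sum)
  also have "\<dots> = (\<Sum>v\<in>U. (1 - 1 / exp 1) * real (min k (?y v)))"
    by (simp only: of_nat_sum sum_distrib_left)
  also have "\<dots> \<le> (\<Sum>v\<in>U. real k * (1 - (1 - 1 / real k) ^ ?y v))"
    using assms(3) by (intro sum_mono min_le_one_minus_power) auto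
  \<comment> \<open>With all covers empty every pair is missing, so each \<open>v\<close> occurs
    \<open>k\<close> times with weight \<open>(1 - 1/k) ^ ?y v\<close>.\<close>
  also have "\<dots> = real k * real (card U) - missing U S n k 0 (\<lambda>_. {})"
    by (simp add: missing_def right_diff_distrib sum_subtractf sum_distrib_left)
  also have "\<dots> \<le> real k * real (card U) - missing U S n k n c"
    using greedy_missing_le[OF assms(4,1,2)] by simp
  also have "\<dots> = real (coverage S k c)"
    using missing_eq_coverage[OF greedy_k_partition[OF assms(4)] assms(1,2)] by simp
  finally show ?thesis .
qed

end
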